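(* Let $\lambda$ be an infinite cardinal and $\chi\le\operatorname{cf}(\lambda)$ a cardinal, and suppose that $E^{\lambda^+}_{\ge\chi}$ contains a non-reflecting stationary subset. Then for every coloring $c:[\lambda^+]^2\to\lambda$ there exists a coloring $c^+:[\lambda^+]^2\to\lambda^+$ such that for every cardinal $\mu\le\lambda$ and every partition $p:[\lambda^+]^2\to\mu$: (1) if $c$ witnesses $\mathrm{pr}_1(\lambda^+,\lambda^+,\lambda,\chi)_p$ then $c^+$ witnesses $\mathrm{pr}_1(\lambda^+,\lambda^+,\lambda^+,\chi)_p$; (2) if $c$ witnesses $\mathrm{pr}_1(\lambda^+,\lambda^+\circledast\lambda^+,\lambda,\chi)_p$ then $c^+$ witnesses $\mathrm{pr}_1(\lambda^+,\lambda^+\circledast\lambda^+,\lambda^+,\chi)_p$.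
   Context: $E^{\lambda^+}_{\ge\chi}=\{\alpha<\lambda^+\mid\operatorname{cf}(\alpha)\ge\chi\}$. A stationary set $S\subseteq\lambda^+$ is non-reflecting iff for no $\alpha<\lambda^+$ of uncountable cofinality is $S\cap\alpha$ stationary in $\alpha$. $[\kappa]^2$ denotes the set of pairs $(\alpha,\beta)$ with $\alpha<\beta<\kappa$; a partition is any function $p:[\kappa]^2\to\mu$. For an ordinal $\sigma$, $[\kappa]^\sigma$ is the set of subsets of $\kappa$ of order type $\sigma$; $a<b$ means every element of $a$ is below every element of $b$. Given $p:[\kappa]^2\to\mu$, a coloring $c:[\kappa]^2\to\theta$ witnesses $\mathrm{pr}_1(\kappa,\kappa,\theta,\chi)_p$ iff for every ordinal $\sigma<\chi$, every pairwise disjoint $\mathcal A\subseteq[\kappa]^\sigma$ of size $\kappa$ and every $\tau:\mu\to\theta$ there are $a,b\in\mathcal A$, $a<b$, with $c(\alpha,\beta)=\tau(p(\alpha,\beta))$ for all $\alpha\in a,\beta\in b$. It witnesses $\mathrm{pr}_1(\kappa,\kappa\circledast\kappa,\theta,\chi)_p$ iff for every ordinal $\sigma<\chi$ and every two families $\mathcal A,\mathcal B\subseteq[\kappa]^\sigma$, each pairwise disjoint and of size $\kappa$, there is $\mathcal A'\subseteq\mathcal A$ of size $\kappa$ such that for every $\tau:\mu\to\theta$ there are $a\in\mathcal A'$, $b\in\mathcal B$, $a<b$, with $c(\alpha,\beta)=\tau(p(\alpha,\beta))$ for all $\alpha\in a,\beta\in b$. *)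

theory Defs
  imports Main "HOL-Library.Countable_Set"
begin

text \<open>Setting: a type 'a carrying a well-order r on UNIV which is an initial
ordinal (card_order r).  Ordinals below the order type of r are the elements of 'a;
the ordinal alpha is identified with the initial segment underS r alpha.\<close>

definition olt :: "'a rel \<Rightarrow> 'a \<Rightarrow> 'a \<Rightarrow> bool" where
  "olt r x y \<longleftrightarrow> (x, y) \<in> r \<and> x \<noteq> y"

definition is_cardinal :: "'a rel \<Rightarrow> 'a \<Rightarrow> bool" where
  "is_cardinal r k \<longleftrightarrow> card_order_on (underS r k) (Restr r (underS r k))"

definition is_succ_of :: "'a rel \<Rightarrow> 'a \<Rightarrow> bool" where
  "is_succ_of r l \<longleftrightarrow> card_order r \<and> is_cardinal r l \<and>
     (card_of (UNIV :: 'a set), cardSuc (card_of (underS r l))) \<in> ordIso"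

definition cofinal_in :: "'a rel \<Rightarrow> 'a set \<Rightarrow> 'a set \<Rightarrow> bool" where
  "cofinal_in r D X \<longleftrightarrow> X \<subseteq> D \<and> (\<forall>b\<in>D. \<exists>x\<in>X. (b, x) \<in> r)"

definition cf_ge :: "'a rel \<Rightarrow> 'a \<Rightarrow> 'a \<Rightarrow> bool" where
  "cf_ge r a k \<longleftrightarrow> (\<forall>X. cofinal_in r (underS r a) X \<longrightarrow>
       (card_of (underS r k), card_of X) \<in> ordLeq)"

definition uncountable_cf :: "'a rel \<Rightarrow> 'a \<Rightarrow> bool" where
  "uncountable_cf r a \<longleftrightarrow> (\<forall>X. cofinal_in r (underS r a) X \<longrightarrow> \<not> countable X)"

definition limit_point :: "'a rel \<Rightarrow> 'a set \<Rightarrow> 'a \<Rightarrow> bool" where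
  "limit_point r C g \<longleftrightarrow> underS r g \<noteq> {} \<and>
     (\<forall>b\<in>underS r g. \<exists>c\<in>C. olt r b c \<and> olt r c g)"

definition club_in :: "'a rel \<Rightarrow> 'a set \<Rightarrow> 'a set \<Rightarrow> bool" where
  "club_in r D C \<longleftrightarrow> cofinal_in r D C \<and> (\<forall>g\<in>D. limit_point r C g \<longrightarrow> g \<in> C)"

definition stationary_in :: "'a rel \<Rightarrow> 'a set \<Rightarrow> 'a set \<Rightarrow> bool" where
  "stationary_in r D S \<longleftrightarrow> S \<subseteq> D \<and> (\<forall>C. club_in r D C \<longrightarrow> S \<inter> C \<noteq> {})"

definition nonreflecting_stationary :: "'a rel \<Rightarrow> 'a set \<Rightarrow> bool" where
  "nonreflecting_stationary r S \<longleftrightarrow> stationary_in r UNIV S \<and>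
     (\<forall>a. uncountable_cf r a \<longrightarrow> \<not> stationary_in r (underS r a) (S \<inter> underS r a))"

definition set_less :: "'a rel \<Rightarrow> 'a set \<Rightarrow> 'a set \<Rightarrow> bool" where
  "set_less r a b \<longleftrightarrow> (\<forall>x\<in>a. \<forall>y\<in>b. olt r x y)"

definition good_family :: "'a rel \<Rightarrow> 'a \<Rightarrow> 'a set set \<Rightarrow> bool" where
  "good_family r s A \<longleftrightarrow>
     (\<forall>a\<in>A. (Restr r a, Restr r (underS r s)) \<in> ordIso) \<and>
     (\<forall>a\<in>A. \<forall>b\<in>A. a \<noteq> b \<longrightarrow> a \<inter> b = {}) \<and>
     (card_of A, card_of (UNIV :: 'a set)) \<in> ordIso"

text \<open>Colorings c, partitions p are functions 'a => 'a => 'a, only evaluated on pairs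
x < y.  Theta is the target set of colours (underS r theta, or UNIV for lambda^+);
mu is the number of cells of p; chi the bound on order types.\<close>
definition pr1 :: "'a rel \<Rightarrow> 'a set \<Rightarrow> 'a \<Rightarrow> ('a \<Rightarrow> 'a \<Rightarrow> 'a) \<Rightarrow> ('a \<Rightarrow> 'a \<Rightarrow> 'a)
     \<Rightarrow> 'a \<Rightarrow> bool" where
  "pr1 r Theta mu p c chi \<longleftrightarrow>
     (\<forall>s\<in>underS r chi. \<forall>A. good_family r s A \<longrightarrow>
        (\<forall>\<tau>. (\<forall>i\<in>underS r mu. \<tau> i \<in> Theta) \<longrightarrow>
           (\<exists>a\<in>A. \<exists>b\<in>A. set_less r a b \<and> (\<forall>x\<in>a. \<forall>y\<in>b. c x y = \<tau> (p x y)))))"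

definition pr1_circ :: "'a rel \<Rightarrow> 'a set \<Rightarrow> 'a \<Rightarrow> ('a \<Rightarrow> 'a \<Rightarrow> 'a) \<Rightarrow> ('a \<Rightarrow> 'a \<Rightarrow> 'a)
     \<Rightarrow> 'a \<Rightarrow> bool" where
  "pr1_circ r Theta mu p c chi \<longleftrightarrow>
     (\<forall>s\<in>underS r chi. \<forall>A B. good_family r s A \<and> good_family r s B \<longrightarrow>
        (\<exists>A' \<subseteq> A. (card_of A', card_of (UNIV :: 'a set)) \<in> ordIso \<and>
          (\<forall>\<tau>. (\<forall>i\<in>underS r mu. \<tau> i \<in> Theta) \<longrightarrow>
             (\<exists>a\<in>A'. \<exists>b\<in>B. set_less r a b \<and> (\<forall>x\<in>a. \<forall>y\<in>b. c x y = \<tau> (p x y))))))"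

end

theory Submission
  imports Defs
begin

text \<open>Fix sets \<open>C a\<close> cofinal in \<open>a\<close> none of whose limit points below \<open>a\<close> lies in \<open>S\<close>, and
walk down from \<open>\<beta>\<close> to \<open>\<alpha>\<close> along them. For \<open>x \<in> S\<close> below \<open>\<beta>\<close>, every walk from \<open>\<beta>\<close> to an
\<open>\<alpha> < x\<close> close enough to \<open>x\<close> passes through \<open>x\<close>; since \<open>cf x \<ge> \<chi>\<close>, ``close enough'' can be
chosen uniformly for all \<open>\<beta>\<close> in a set of size \<open>< \<chi>\<close>.

Fix also a height function \<open>g\<close> into \<open>\<lambda>\<close> such that \<open>{x \<in> S. g x \<ge> k}\<close> is stationary for each
\<open>k < \<lambda>\<close>. A colour \<open>c \<alpha> \<beta>\<close> is read as a triple \<open>(k, i, m)\<close>: take the first point \<open>w\<close> of height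
at least \<open>k\<close> on the walk, let \<open>\<eta>\<close> be the \<open>i\<close>-th element of \<open>w\<close>, and output the \<open>m\<close>-th element
of \<open>\<eta>\<close>. Given \<open>\<tau>\<close>, choose \<open>\<eta>\<close> above its range. Because \<open>\<chi> \<le> cf \<lambda>\<close>, the heights on the upper
part of the walks from a member of the family to some \<open>\<delta> \<in> S\<close> lie below a single \<open>k\<close>. Below
such a \<open>\<delta>\<close>, aim at an \<open>x \<in> S\<close> of height at least \<open>k\<close>: all walks now share the same \<open>w\<close>, and
Fodor's lemma makes the index \<open>i\<close> of \<open>\<eta>\<close> in \<open>w\<close> independent of \<open>x\<close>. So a suitable \<open>\<tau>'\<close> into
\<open>\<lambda>\<close> for \<open>c\<close> produces \<open>\<tau>\<close> for the new colouring.\<close>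

unbundle cardinal_syntax

section \<open>Order and cardinal arithmetic below a successor cardinal\<close>

locale successor_cardinal =
  fixes r :: "'a rel" and l :: 'a
  assumes succ: "is_succ_of r l" and inf: "infinite (underS r l)"
begin

abbreviation le (infix "\<preceq>" 50) where "x \<preceq> y \<equiv> (x, y) \<in> r"
abbreviation lt (infix "\<prec>" 50) where "x \<prec> y \<equiv> olt r x y"

lemma card_order_r: "card_order r"
  using succ by (simp add: is_succ_of_def)

lemma Well_order_r: "Well_order r" and Field_r: "Field r = UNIV"
  using card_order_r card_order_on_well_order_on well_order_on_Well_order by fastforce+

sublocale ord: wellorder "\<lambda>x y. x \<preceq> y" "olt r"
proof -
  have lin: "refl r" "trans r" "antisym r" "total r" and wf: "wf (r - Id)"
    using Well_order_r Field_r
    by (auto simp: well_order_on_def linear_order_on_def partial_order_on_def preorder_on_def)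
  show "class.wellorder (\<lambda>x y. x \<preceq> y) (olt r)"
  proof
    fix x y z
    show "x \<prec> y \<longleftrightarrow> x \<preceq> y \<and> \<not> y \<preceq> x"
      using lin by (auto simp: olt_def refl_on_def antisym_def)
    show "x \<preceq> x" using lin by (auto simp: refl_on_def)
    show "x \<preceq> y \<Longrightarrow> y \<preceq> z \<Longrightarrow> x \<preceq> z" using lin by (auto dest: transD)
    show "x \<preceq> y \<Longrightarrow> y \<preceq> x \<Longrightarrow> x = y" using lin by (auto dest: antisymD)
    show "x \<preceq> y \<or> y \<preceq> x" using lin by (cases "x = y") (auto simp: total_on_def refl_on_def)
  next
    fix P a
    assume "\<And>x. (\<And>y. y \<prec> x \<Longrightarrow> P y) \<Longrightarrow> P x"
    then show "P a"
      using wf_induct_rule[OF wf, of P a] by (auto simp: olt_def)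
  qed
qed

lemma mem_underS [simp]: "y \<in> underS r x \<longleftrightarrow> y \<prec> x"
  by (auto simp: underS_def olt_def)

lemma common_bound: "a \<prec> x \<Longrightarrow> b \<prec> x \<Longrightarrow> \<exists>u. a \<preceq> u \<and> b \<preceq> u \<and> u \<prec> x"
  using ord.linear[of a b] ord.order_refl by blast

lemma wf_lt: "wf {(x, y). x \<prec> y}"
  using ord.less_induct by (auto simp: wf_def)

lemma card_UNIV: "|UNIV :: 'a set| =o cardSuc |underS r l|"
  using succ by (simp add: is_succ_of_def)

lemma not_UNIV_le: "\<not> |UNIV :: 'a set| \<le>o |underS r l|"
  using card_UNIV cardSuc_greater[OF card_of_Card_order]
  by (metis not_ordLess_ordLeq ordIso_ordLeq_trans ordIso_symmetric)

lemma not_card_le: "\<not> |A| \<le>o |B| \<longleftrightarrow> |B| <o |A|"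
  by (simp add: not_ordLeq_iff_ordLess card_of_Well_order)

lemma finite_le_infinite: "finite A \<Longrightarrow> infinite B \<Longrightarrow> |A| \<le>o |B|"
  by (metis card_of_ordLeq_finite not_card_le ordLess_imp_ordLeq)

lemma card_le_or_UNIV: "|X :: 'a set| \<le>o |underS r l| \<or> |X| =o |UNIV :: 'a set|"
proof (cases "|X| \<le>o |underS r l|")
  case False
  then have "|underS r l| <o |X|" by (simp add: not_card_le)
  then have "cardSuc |underS r l| \<le>o |X|" by (intro cardSuc_least card_of_Card_order)
  then show ?thesis
    using card_UNIV card_of_mono1[OF subset_UNIV] ordIso_ordLeq_trans ordIso_iff_ordLeq by blast
qed simp

lemma card_underS_le: "|underS r w| \<le>o |underS r l|"
proof -
  have "|underS r w| <o r"
    using card_of_underS[of r w] card_order_r Field_r by auto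
  also have "r =o |UNIV :: 'a set|"
    using card_of_unique card_order_r by blast
  also have "|UNIV :: 'a set| =o cardSuc |underS r l|" by (rule card_UNIV)
  finally show ?thesis
    using cardSuc_ordLeq_ordLess[of "|underS r l|" "|underS r w|"] card_of_Card_order by blast
qed

text \<open>Regularity of the successor: were \<open>X\<close> unbounded, the closed initial
  segments ending in \<open>X\<close> would be at most \<open>l\<close> many sets of size at most
  \<open>l\<close> covering the whole type.\<close>

lemma bounded:
  assumes "|X| \<le>o |underS r l|"
  shows "\<exists>u. \<forall>x\<in>X. x \<prec> u"
proof (rule ccontr)
  assume no: "\<not> ?thesis"
  have "|insert x (underS r x)| \<le>o |underS r l|" for x
    using card_of_Un_ordLeq_infinite_Field[of "|underS r l|" "{x}" "underS r x"] card_underS_le[of x] inf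
      finite_le_infinite[of "{x}" "underS r l"] card_of_card_order_on[of "underS r l"]
    by (simp add: Field_card_of)
  then have "|\<Union>x\<in>X. insert x (underS r x)| \<le>o |underS r l|"
    by (intro card_of_UNION_ordLeq_infinite[OF inf assms] ballI)
  moreover have "(\<Union>x\<in>X. insert x (underS r x)) = UNIV"
    using no by (force simp: ord.not_less ord.le_less)
  ultimately show False using not_UNIV_le by simp
qed

lemma cardinal_underS:
  assumes "is_cardinal r k" and "v \<prec> k"
  shows "|underS r v| <o |underS r k|"
proof -
  let ?R = "Restr r (underS r k)"
  have c: "card_order_on (underS r k) ?R" using assms(1) by (simp add: is_cardinal_def)
  then have f: "Field ?R = underS r k" using card_order_on_Card_order by blast
  have "underS ?R v = underS r v"
    using assms(2) by (auto simp: underS_def olt_def dest: ord.order_trans ord.order.antisym)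
  then have "|underS r v| <o ?R"
    using card_of_underS[of ?R v] c f assms(2) by (simp)
  then show ?thesis
    using card_of_unique[OF c] ordLess_ordIso_trans by blast
qed

lemma l_cardinal: "is_cardinal r l"
  using succ by (simp add: is_succ_of_def)

section \<open>Stationary sets and pressing down\<close>

text \<open>Stationarity, phrased through closure points of functions rather than clubs: this makes
Fodor's lemma immediate and avoids diagonal intersections.\<close>

definition stat :: "'a set \<Rightarrow> bool" where
  "stat S \<longleftrightarrow> (\<forall>G. \<exists>x\<in>S. (\<exists>v. v \<prec> x) \<and> (\<forall>v. v \<prec> x \<longrightarrow> G v \<prec> x))"

lemma statD: "stat S \<Longrightarrow> \<exists>x\<in>S. (\<exists>v. v \<prec> x) \<and> (\<forall>v. v \<prec> x \<longrightarrow> G v \<prec> x)"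
  by (auto simp: stat_def)

lemma not_stat:
  "\<not> stat S \<Longrightarrow> \<exists>G. \<forall>x\<in>S. (\<exists>v. v \<prec> x) \<longrightarrow> (\<exists>t. t \<prec> x \<and> \<not> G t \<prec> x)"
  unfolding stat_def by simp meson

lemma countable_bounded: "\<exists>u. \<forall>n :: nat. y n \<prec> u"
proof -
  have "|range y| \<le>o |UNIV :: nat set|" by (rule card_of_image)
  also have "|UNIV :: nat set| \<le>o |underS r l|" using inf infinite_iff_card_of_nat by blast
  finally show ?thesis using bounded by blast
qed

lemma strict_bound2: "\<exists>u. x \<prec> u \<and> y \<prec> u"
  using countable_bounded[of "\<lambda>n. if n = 0 then x else y"] by (metis zero_neq_one)

text \<open>This stands in for a diagonal intersection: a point closed under \<open>G'\<close> is
  closed under every \<open>G v\<close> with \<open>v\<close> below it. The values to be bounded at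
  \<open>u\<close> are indexed by pairs up to \<open>u\<close>, so regularity applies.\<close>

lemma sup_initial:
  "\<exists>G'. \<forall>u v t. v \<preceq> u \<and> t \<preceq> u \<longrightarrow> (G v t :: 'a) \<prec> G' u"
proof -
  have "\<exists>m. \<forall>v t. v \<preceq> u \<and> t \<preceq> u \<longrightarrow> G v t \<prec> m" for u
  proof -
    \<comment> \<open>Initial segments are open, so \<open>u'\<close> is needed to include the index
      \<open>u\<close> itself.\<close>
    obtain u' where u': "u \<prec> u'" using strict_bound2 by blast
    have "|underS r u' \<times> underS r u'| \<le>o |underS r l|"
      by (intro card_of_Sigma_ordLeq_infinite[OF inf] ballI card_underS_le)
    then have "|(\<lambda>(v, t). G v t) ` (underS r u' \<times> underS r u')| \<le>o |underS r l|"
      using card_of_image ordLeq_transitive by blast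
    then obtain m where "\<forall>z\<in>(\<lambda>(v, t). G v t) ` (underS r u' \<times> underS r u'). z \<prec> m"
      using bounded by blast
    then have m: "G v t \<prec> m" if "v \<prec> u'" "t \<prec> u'" for v t
      using that by auto
    show ?thesis
    proof (intro exI allI impI)
      fix v t assume "v \<preceq> u \<and> t \<preceq> u"
      then have "v \<prec> u'" "t \<prec> u'" using u' ord.le_less_trans by blast+
      then show "G v t \<prec> m" by (rule m)
    qed
  qed
  then show ?thesis by metis
qed

text \<open>The closure points of any \<open>G\<close> form a club: iterating a bound for
  \<open>G\<close> countably often from \<open>b\<close> leads to one above \<open>b\<close>, and
  limits of closure points are closure points.\<close>

lemma stationary_imp_stat:
  assumes "stationary_in r UNIV S"
  shows "stat S"
  unfolding stat_def
proof
  fix G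
  define C where "C = {x. (\<exists>v. v \<prec> x) \<and> (\<forall>v. v \<prec> x \<longrightarrow> G v \<prec> x)}"
  have "club_in r UNIV C"
    unfolding club_in_def cofinal_in_def
  proof (intro conjI ballI impI)
    fix b
    \<comment> \<open>The diagonal of this auxiliary function is \<open>G\<close>, so
      \<open>G' u\<close> bounds \<open>G v\<close> for all \<open>v \<preceq> u\<close>.\<close>
    obtain G' where G': "\<And>u v t. v \<preceq> u \<Longrightarrow> t \<preceq> u \<Longrightarrow> (if v = t then G v else v) \<prec> G' u"
      using sup_initial[of "\<lambda>v t. if v = t then G v else v"] by blast
    have "\<forall>u. \<exists>k. G' u \<prec> k \<and> u \<prec> k" using strict_bound2 by blast
    then obtain G2 where G2: "\<And>u. G' u \<prec> G2 u \<and> u \<prec> G2 u" by metis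
    define y where "y n = (G2 ^^ n) b" for n
    obtain u where "\<forall>n. y n \<prec> u" using countable_bounded by blast
    then obtain x where x: "\<And>n. y n \<prec> x" and min: "\<And>z. z \<prec> x \<Longrightarrow> \<exists>n. \<not> y n \<prec> z"
      using ord.exists_least_iff[of "\<lambda>z. \<forall>n. y n \<prec> z"] by blast
    have "G v \<prec> x" if v: "v \<prec> x" for v
    proof -
      obtain n where "v \<preceq> y n" using min[OF v] ord.not_less by blast
      then have "G v \<prec> G' (y n)" using G'[of v "y n" v] by simp
      also have "G' (y n) \<prec> y (Suc n)" using G2 by (simp add: y_def)
      also have "\<dots> \<prec> x" by (rule x)
      finally show ?thesis .
    qed
    then have "x \<in> C" using x by (auto simp: C_def)
    moreover have "b \<preceq> x" using x[of 0] by (simp add: y_def ord.less_imp_le)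
    ultimately show "\<exists>x\<in>C. b \<preceq> x" by blast
  next
    fix g assume g: "limit_point r C g"
    then have "G v \<prec> g" if "v \<prec> g" for v
      using that ord.less_trans unfolding limit_point_def C_def
      by (metis (mono_tags, lifting) mem_Collect_eq mem_underS)
    then show "g \<in> C"
      using g unfolding limit_point_def C_def by fastforce
  qed simp
  then obtain x where "x \<in> S" "x \<in> C" using assms by (auto simp: stationary_in_def)
  then show "\<exists>x\<in>S. (\<exists>v. v \<prec> x) \<and> (\<forall>v. v \<prec> x \<longrightarrow> G v \<prec> x)" by (auto simp: C_def)
qed

text \<open>Testing the smaller set against \<open>H\<close> reduces to testing \<open>S\<close>
  against a common bound \<open>K\<close> of \<open>G\<close> and \<open>H\<close>.\<close>

lemma stat_closed:
  assumes "stat S"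
  shows "stat {x \<in> S. \<forall>v. v \<prec> x \<longrightarrow> G v \<prec> x}"
  unfolding stat_def
proof
  fix H
  have "\<forall>v. \<exists>k. G v \<prec> k \<and> H v \<prec> k" using strict_bound2 by blast
  then obtain K where K: "\<And>v. G v \<prec> K v \<and> H v \<prec> K v" by metis
  obtain x where x: "x \<in> S" "\<exists>v. v \<prec> x" "\<And>v. v \<prec> x \<Longrightarrow> K v \<prec> x"
    using statD[OF assms, of K] by blast
  show "\<exists>x\<in>{x \<in> S. \<forall>v. v \<prec> x \<longrightarrow> G v \<prec> x}. (\<exists>v. v \<prec> x) \<and> (\<forall>v. v \<prec> x \<longrightarrow> H v \<prec> x)"
  proof (intro bexI[of _ x] conjI allI impI CollectI)
    show "G v \<prec> x" "H v \<prec> x" if "v \<prec> x" for v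
      using x(3)[OF that] K[of v] ord.less_trans by blast+
  qed (use x in auto)
qed

lemma stat_mono: "stat S \<Longrightarrow> S \<subseteq> T \<Longrightarrow> stat T"
  unfolding stat_def by blast

lemma stat_above:
  assumes "stat S"
  shows "stat {x \<in> S. u \<prec> x}"
  unfolding stat_def
proof
  fix H
  obtain x where "x \<in> S" "\<exists>v. v \<prec> x" "\<And>v. v \<prec> x \<Longrightarrow> H v \<prec> x" "\<And>v. v \<prec> x \<Longrightarrow> u \<prec> x"
    using statD[OF stat_closed[OF assms, of "\<lambda>v. u"], of H] by blast
  then show "\<exists>x\<in>{x \<in> S. u \<prec> x}. (\<exists>v. v \<prec> x) \<and> (\<forall>v. v \<prec> x \<longrightarrow> H v \<prec> x)" by blast
qed

lemma stat_unbounded: "stat S \<Longrightarrow> \<exists>x\<in>S. u \<prec> x"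
  using statD[OF stat_above[of S u]] by blast

text \<open>If no fibre were stationary, the failures would be witnessed by functions
  \<open>G v\<close>; a point \<open>x\<close> of \<open>S\<close> closed under their common bound
  \<open>G'\<close> would be closed under its own \<open>G (f x)\<close>, a contradiction.\<close>

lemma fodor:
  assumes S: "stat S" and f: "\<And>x. x \<in> S \<Longrightarrow> (\<exists>v. v \<prec> x) \<Longrightarrow> f x \<prec> x"
  shows "\<exists>v. stat {x \<in> S. f x = v}"
proof (rule ccontr)
  assume "\<not> ?thesis"
  then have "\<exists>G. \<forall>x\<in>{x \<in> S. f x = v}. (\<exists>v. v \<prec> x) \<longrightarrow> (\<exists>t. t \<prec> x \<and> \<not> G t \<prec> x)" for v
    using not_stat[of "{x \<in> S. f x = v}"] by blast
  then obtain G where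
    "\<And>v. \<forall>x\<in>{x \<in> S. f x = v}. (\<exists>v. v \<prec> x) \<longrightarrow> (\<exists>t. t \<prec> x \<and> \<not> G v t \<prec> x)"
    by metis
  then have G: "\<exists>t. t \<prec> x \<and> \<not> G v t \<prec> x" if "x \<in> S" "f x = v" "\<exists>v. v \<prec> x" for v x
    using that by simp
  obtain G' where G': "\<And>u v t. v \<preceq> u \<Longrightarrow> t \<preceq> u \<Longrightarrow> G v t \<prec> G' u"
    using sup_initial[of G] by blast
  obtain x where x: "x \<in> S" "\<exists>v. v \<prec> x" "\<And>v. v \<prec> x \<Longrightarrow> G' v \<prec> x"
    using statD[OF S, of G'] by blast
  obtain t where t: "t \<prec> x" "\<not> G (f x) t \<prec> x" using G[OF x(1) refl x(2)] by blast
  have "f x \<prec> x" using f x by blast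
  then obtain u where "f x \<preceq> u" "t \<preceq> u" "u \<prec> x"
    using common_bound t(1) by blast
  then show False using G'[of "f x" u t] x(3) t(2) ord.less_trans by blast
qed

text \<open>Pressing down twice: once \<open>f\<close> is constant, restriction to points above
  \<open>l\<close> makes \<open>h\<close> regressive as well.\<close>

lemma fodor_l:
  assumes S: "stat S" and f: "\<And>x. x \<in> S \<Longrightarrow> (\<exists>v. v \<prec> x) \<Longrightarrow> f x \<prec> x"
    and h: "\<And>x. x \<in> S \<Longrightarrow> (\<exists>v. v \<prec> x) \<Longrightarrow> h x \<prec> l"
  shows "\<exists>v i. stat {x \<in> S. f x = v \<and> h x = i}"
proof -
  obtain v where v: "stat {x \<in> S. f x = v}" using fodor[OF S f] by blast
  have "\<exists>i. stat {x \<in> {x \<in> {x \<in> S. f x = v}. l \<prec> x}. h x = i}"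
    using h ord.less_trans by (intro fodor[OF stat_above[OF v]]) auto
  then obtain i where "stat {x \<in> {x \<in> {x \<in> S. f x = v}. l \<prec> x}. h x = i}" by blast
  then have "stat {x \<in> S. f x = v \<and> h x = i}" by (rule stat_mono) blast
  then show ?thesis by blast
qed

section \<open>Cofinalities, and cofinal sets with no limit points in \<open>S\<close>\<close>

text \<open>Were the values \<open>f y\<close> unbounded in \<open>x\<close>, they would form a
  cofinal set with fewer than \<open>chi\<close> elements.\<close>

lemma cf_bound:
  assumes "cf_ge r x chi" and "|b| <o |underS r chi|" and "\<And>y. y \<in> b \<Longrightarrow> f y \<prec> x"
  shows "\<exists>e. e \<prec> x \<and> (\<forall>y\<in>b. f y \<prec> e)"
proof (rule ccontr)
  assume no: "\<not> ?thesis"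
  have "cofinal_in r (underS r x) (f ` b)"
    unfolding cofinal_in_def
  proof (intro conjI ballI)
    show "f ` b \<subseteq> underS r x" using assms(3) by auto
    fix e assume "e \<in> underS r x"
    then obtain y where "y \<in> b" "\<not> f y \<prec> e" using no by auto
    then show "\<exists>y\<in>f ` b. e \<preceq> y" by (auto simp: ord.not_less)
  qed
  then have "|underS r chi| \<le>o |f ` b|" using assms(1) by (simp add: cf_ge_def)
  then have "|underS r chi| \<le>o |b|" using card_of_image ordLeq_transitive by blast
  then show False using assms(2) not_ordLess_ordLeq by blast
qed

lemma limit_point_infinite:
  assumes "limit_point r C x"
  shows "infinite {c \<in> C. c \<prec> x}"
proof (rule ord.infinite_growing)
  show "{c \<in> C. c \<prec> x} \<noteq> {}" using assms by (force simp: limit_point_def)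
  fix y assume "y \<in> {c \<in> C. c \<prec> x}"
  then show "\<exists>z\<in>{c \<in> C. c \<prec> x}. y \<prec> z" using assms by (force simp: limit_point_def)
qed

text \<open>If \<open>a\<close> has uncountable cofinality, nonreflection supplies a club of
  \<open>a\<close> disjoint from \<open>S\<close>, and a club contains its limit points. Otherwise a
  countable cofinal set is thinned until no limit points remain below \<open>a\<close>.\<close>

lemma ex_cofinal_avoiding:
  assumes nr: "\<And>a. uncountable_cf r a \<Longrightarrow> \<not> stationary_in r (underS r a) (S \<inter> underS r a)"
  shows "\<exists>C. cofinal_in r (underS r a) C \<and> (\<forall>x\<in>S. x \<prec> a \<longrightarrow> \<not> limit_point r C x)"
proof (cases "uncountable_cf r a")
  case True
  then obtain C where "club_in r (underS r a) C" "(S \<inter> underS r a) \<inter> C = {}"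
    using nr by (auto simp: stationary_in_def)
  then show ?thesis by (intro exI[of _ C]) (auto simp: club_in_def)
next
  case False
  then obtain X where X: "cofinal_in r (underS r a) X" "countable X"
    by (auto simp: uncountable_cf_def)
  show ?thesis
  proof (cases "X = {}")
    case True
    then show ?thesis
      using X limit_point_infinite[of "{}"] by (intro exI[of _ "{}"]) auto
  next
    case False
    then obtain f :: "nat \<Rightarrow> 'a" where f: "X = range f"
      using X(2) uncountable_def by metis
    \<comment> \<open>The record values of the enumeration. They stay cofinal, and those below a
      given \<open>x \<prec> a\<close> occur before any index whose value is at least
      \<open>x\<close>, so they are finite in number.\<close>
    define C where "C = {f n | n. \<forall>m\<le>n. f m \<preceq> f n}"
    have max: "\<exists>k\<le>n. \<forall>m\<le>n. f m \<preceq> f k" for n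
    proof (induction n)
      case (Suc n)
      then obtain k where k: "k \<le> n" "\<forall>m\<le>n. f m \<preceq> f k" by blast
      show ?case
      proof (cases "f k \<preceq> f (Suc n)")
        case True
        then show ?thesis
          using k by (intro exI[of _ "Suc n"]) (auto simp: le_Suc_eq intro: ord.order_trans)
      next
        case False
        then show ?thesis
          using k ord.linear by (intro exI[of _ k]) (auto simp: le_Suc_eq)
      qed
    qed simp
    have reach: "\<exists>n. b \<preceq> f n" if "b \<prec> a" for b
      using X(1) f that by (auto simp: cofinal_in_def)
    have "cofinal_in r (underS r a) C"
      unfolding cofinal_in_def
    proof (intro conjI ballI)
      show "C \<subseteq> underS r a" using X(1) f by (auto simp: C_def cofinal_in_def)
      fix b assume "b \<in> underS r a"
      then obtain n where n: "b \<preceq> f n" using reach by auto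
      obtain k where "k \<le> n" "\<forall>m\<le>n. f m \<preceq> f k" using max by blast
      then show "\<exists>x\<in>C. b \<preceq> x"
        using n by (intro bexI[of _ "f k"]) (auto simp: C_def intro: ord.order_trans)
    qed
    moreover have "\<not> limit_point r C x" if x: "x \<prec> a" for x
    proof
      assume "limit_point r C x"
      then have "infinite {c \<in> C. c \<prec> x}" by (rule limit_point_infinite)
      moreover obtain n where n: "x \<preceq> f n" using reach x by blast
      have "{c \<in> C. c \<prec> x} \<subseteq> f ` {..<n}"
      proof
        fix c assume "c \<in> {c \<in> C. c \<prec> x}"
        then obtain m where m: "c = f m" "\<forall>j\<le>m. f j \<preceq> f m" "f m \<prec> x" by (auto simp: C_def)
        then have "\<not> n \<le> m" using n by (meson ord.leD ord.order_trans)
        then show "c \<in> f ` {..<n}" using m by auto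
      qed
      ultimately show False using finite_subset by blast
    qed
    ultimately show ?thesis by blast
  qed
qed

section \<open>Enumerations by indices below \<open>l\<close>, and the height function\<close>

lemma ex_enumeration:
  "\<exists>idx. \<forall>w. inj_on (idx w) (underS r w) \<and> (\<forall>v. v \<prec> w \<longrightarrow> idx w v \<prec> l)"
proof -
  have "\<exists>f. inj_on f (underS r w) \<and> (\<forall>v. v \<prec> w \<longrightarrow> f v \<prec> l)" for w
  proof -
    obtain f where "inj_on f (underS r w)" "f ` underS r w \<subseteq> underS r l"
      using card_underS_le[of w] unfolding card_of_ordLeq[symmetric] by blast
    then show ?thesis by (intro exI[of _ f]) (simp add: image_subset_iff)
  qed
  then show ?thesis by metis
qed

text \<open>An Ulam matrix argument: if for every \<open>\<eta>\<close> the heights \<open>idx x \<eta>\<close> were bounded on almost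
all of \<open>S\<close>, some \<open>x\<close> would inject \<open>l\<close> many \<open>\<eta>\<close> into a fixed \<open>k \<prec> l\<close>.\<close>

lemma ex_height:
  assumes S: "stat S"
  shows "\<exists>g. (\<forall>x. g x \<prec> l) \<and> (\<forall>k. k \<prec> l \<longrightarrow> stat {x \<in> S. k \<preceq> g x})"
proof -
  obtain idx where inj: "\<And>w. inj_on (idx w) (underS r w)"
    and idx: "\<And>w v. v \<prec> w \<Longrightarrow> idx w v \<prec> l"
    using ex_enumeration by metis
  have "\<exists>\<eta>. \<forall>k. k \<prec> l \<longrightarrow> stat {x \<in> S. \<eta> \<prec> x \<and> k \<preceq> idx x \<eta>}"
  proof (rule ccontr)
    assume "\<not> ?thesis"
    then have "\<forall>\<eta>. \<exists>k. k \<prec> l \<and> \<not> stat {x \<in> S. \<eta> \<prec> x \<and> k \<preceq> idx x \<eta>}" by blast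
    from choice[OF this] obtain K where K: "\<And>\<eta>. K \<eta> \<prec> l"
      and ns: "\<And>\<eta>. \<not> stat {x \<in> S. \<eta> \<prec> x \<and> K \<eta> \<preceq> idx x \<eta>}" by auto
    have "\<forall>\<eta>. \<exists>G. \<forall>x\<in>{x \<in> S. \<eta> \<prec> x \<and> K \<eta> \<preceq> idx x \<eta>}.
        (\<exists>v. v \<prec> x) \<longrightarrow> (\<exists>t. t \<prec> x \<and> \<not> G t \<prec> x)"
      using not_stat[OF ns] by (intro allI)
    from choice[OF this] obtain G where G: "\<And>\<eta>. \<forall>x\<in>{x \<in> S. \<eta> \<prec> x \<and> K \<eta> \<preceq> idx x \<eta>}.
        (\<exists>v. v \<prec> x) \<longrightarrow> (\<exists>t. t \<prec> x \<and> \<not> G \<eta> t \<prec> x)"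
      by blast
    obtain G' where G': "\<And>u v t. v \<preceq> u \<Longrightarrow> t \<preceq> u \<Longrightarrow> G v t \<prec> G' u"
      using sup_initial[of G] by blast
    \<comment> \<open>Above \<open>l\<close> the bound \<open>K\<close> is regressive, hence
      constant on a stationary set. That set is unbounded, so \<open>H\<close> below has more than
      \<open>l\<close> elements.\<close>
    have "\<exists>k. stat {x \<in> {x \<in> S. l \<prec> x}. K x = k}"
      using K ord.less_trans by (intro fodor[OF stat_above[OF S]]) auto
    then obtain k where st: "stat {x \<in> {x \<in> S. l \<prec> x}. K x = k}" by blast
    have k: "k \<prec> l" using stat_unbounded[OF st] K by auto
    define H where "H = {x. K x = k}"
    have "\<not> |H| \<le>o |underS r l|"
      using bounded[of H] stat_unbounded[OF st] by (auto simp: H_def dest: ord.less_asym)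
    then have "|underS r l| \<le>o |H|"
      by (simp add: not_card_le ordLess_imp_ordLeq)
    then obtain f where f: "inj_on f (underS r l)" "f ` underS r l \<subseteq> H"
      using card_of_ordLeq by metis
    obtain u where u: "\<And>v. v \<prec> l \<Longrightarrow> f v \<prec> u"
      using bounded[OF card_of_image[of f "underS r l"]] by (meson imageI mem_underS)
    \<comment> \<open>\<open>x\<close> lies above \<open>l\<close> many elements \<open>f v\<close>
      of \<open>H\<close> and is closed under each \<open>G (f v)\<close>, so it avoids the
      nonstationary sets of all these \<open>f v\<close>; hence \<open>idx x\<close> sends them
      below \<open>k\<close>.\<close>
    obtain x where x: "x \<in> S" "u \<prec> x" "\<And>v. v \<prec> x \<Longrightarrow> G' v \<prec> x"
      using statD[OF stat_above[OF S], of u G'] by blast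
    have lt: "f v \<prec> x" if "v \<prec> l" for v using u[OF that] x(2) by (rule ord.less_trans)
    have "idx x (f v) \<prec> k" if v: "v \<prec> l" for v
    proof (rule ccontr)
      assume "\<not> ?thesis"
      moreover have "f v \<in> H" using f(2) v by (simp add: image_subset_iff)
      ultimately have "K (f v) \<preceq> idx x (f v)" by (simp add: H_def ord.not_less)
      then obtain t where t: "t \<prec> x" "\<not> G (f v) t \<prec> x" using G[of "f v"] x(1) lt[OF v] by auto
      obtain m where "f v \<preceq> m" "t \<preceq> m" "m \<prec> x"
        using common_bound[OF lt[OF v] t(1)] by blast
      then show False using G'[of "f v" m t] x(3) t(2) ord.less_trans by blast
    qed
    then have "(idx x \<circ> f) ` underS r l \<subseteq> underS r k" by auto
    moreover have "inj_on (idx x \<circ> f) (underS r l)"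
      using f(1) by (rule comp_inj_on) (rule inj_on_subset[OF inj], use lt in auto)
    ultimately have "|underS r l| \<le>o |underS r k|" using card_of_ordLeq by metis
    then show False using cardinal_underS[OF l_cardinal k] not_ordLess_ordLeq by blast
  qed
  then obtain \<eta> where \<eta>: "\<And>k. k \<prec> l \<Longrightarrow> stat {x \<in> S. \<eta> \<prec> x \<and> k \<preceq> idx x \<eta>}" by blast
  obtain z where z: "z \<prec> l" using inf infinite_imp_nonempty by fastforce
  show ?thesis
  proof (intro exI conjI allI impI)
    fix x show "(if \<eta> \<prec> x then idx x \<eta> else z) \<prec> l" using idx z by simp
  next
    fix k assume "k \<prec> l"
    show "stat {x \<in> S. k \<preceq> (if \<eta> \<prec> x then idx x \<eta> else z)}"
      by (rule stat_mono[OF \<eta>[OF \<open>k \<prec> l\<close>]]) auto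
  qed
qed

section \<open>Disjoint families of sets of fixed order type\<close>

lemma good_card:
  assumes "good_family r s A" and "a \<in> A"
  shows "|a| =o |underS r s|"
proof -
  have "Restr r a =o Restr r (underS r s)" using assms by (simp add: good_family_def)
  then obtain f where "iso (Restr r a) (Restr r (underS r s)) f" by (auto simp: ordIso_def)
  then have "bij_betw f (Field (Restr r a)) (Field (Restr r (underS r s)))" by (simp add: iso_def)
  moreover have "Field (Restr r X) = X" for X
    using ord.order_refl by (fastforce simp: Field_def)
  ultimately show ?thesis using card_of_ordIso by metis
qed

lemma good_disjoint:
  "good_family r s A \<Longrightarrow> a \<in> A \<Longrightarrow> b \<in> A \<Longrightarrow> a \<noteq> b \<Longrightarrow> a \<inter> b = {}"
  by (simp add: good_family_def)

lemma good_bounded: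
  assumes "good_family r s A" and "a \<in> A"
  shows "\<exists>u. \<forall>y\<in>a. y \<prec> u"
  using bounded ordIso_ordLeq_trans[OF good_card[OF assms] card_underS_le] by blast

lemma good_not_small:
  assumes "good_family r s A"
  shows "\<not> |A| \<le>o |underS r l|"
proof
  assume "|A| \<le>o |underS r l|"
  moreover have "|UNIV :: 'a set| =o |A|"
    using assms ordIso_symmetric by (auto simp: good_family_def)
  ultimately show False using not_UNIV_le ordIso_ordLeq_trans by blast
qed

text \<open>One empty member forces the common order type to be zero, so all members are empty and
  the family is finite.\<close>

lemma good_nonempty:
  assumes A: "good_family r s A" and "a \<in> A"
  shows "a \<noteq> {}"
proof
  assume "a = {}"
  then have "|underS r s| =o |{} :: 'a set|"
    using good_card[OF assms] ordIso_symmetric by blast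
  then have "underS r s = {}" using card_of_empty3 ordIso_iff_ordLeq by blast
  then have "b = {}" if "b \<in> A" for b
    using good_card[OF A that] card_of_empty3 ordIso_iff_ordLeq by metis
  then have "A \<subseteq> {{}}" by blast
  then have "finite A" using finite_subset by blast
  then show False
    using good_not_small[OF A] finite_le_infinite[OF _ inf] by blast
qed

text \<open>Otherwise each member has a point at or below \<open>x\<close>; by disjointness these
  points inject the family into a proper initial segment.\<close>

lemma good_above:
  assumes A: "good_family r s A"
  shows "\<exists>a\<in>A. \<forall>y\<in>a. x \<prec> y"
proof (rule ccontr)
  assume "\<not> ?thesis"
  then have "\<forall>a. \<exists>y. a \<in> A \<longrightarrow> y \<in> a \<and> y \<preceq> x" by (auto simp: ord.not_less)
  then obtain f where f: "\<And>a. a \<in> A \<Longrightarrow> f a \<in> a" "\<And>a. a \<in> A \<Longrightarrow> f a \<preceq> x" by metis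
  have "inj_on f A"
    using good_disjoint[OF A] f(1) by (intro inj_onI) (metis disjoint_iff)
  moreover obtain x' where "x \<prec> x'" using strict_bound2 by blast
  then have "f ` A \<subseteq> underS r x'" using f(2) ord.le_less_trans by fastforce
  ultimately have "|A| \<le>o |underS r x'|" using card_of_ordLeq by blast
  then show False
    using good_not_small[OF A] card_underS_le ordLeq_transitive by blast
qed

text \<open>Points chosen from the members of \<open>B\<close> form an unbounded set, which has full
  size by regularity.\<close>

lemma good_subfamily:
  assumes A: "good_family r s A" and sub: "B \<subseteq> A" and above: "\<And>u. \<exists>b\<in>B. \<forall>y\<in>b. u \<prec> y"
  shows "good_family r s B"
proof -
  have "\<forall>b. \<exists>y. b \<in> B \<longrightarrow> y \<in> b" using good_nonempty[OF A] sub by blast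
  then obtain f where f: "\<And>b. b \<in> B \<Longrightarrow> f b \<in> b" by metis
  have "\<not> |B| \<le>o |underS r l|"
  proof
    assume "|B| \<le>o |underS r l|"
    then have "|f ` B| \<le>o |underS r l|" using card_of_image ordLeq_transitive by blast
    then obtain u where "\<And>b. b \<in> B \<Longrightarrow> f b \<prec> u" using bounded[of "f ` B"] by auto
    then show False using above[of u] f ord.less_asym by blast
  qed
  moreover have "inj_on f B"
    using good_disjoint[OF A] f sub by (intro inj_onI) (metis disjoint_iff subsetD)
  then have "|B| =o |f ` B|" using card_of_ordIso inj_on_imp_bij_betw by blast
  ultimately have "|B| =o |UNIV :: 'a set|"
    using card_le_or_UNIV[of "f ` B"] ordIso_transitive ordIso_ordLeq_trans by blast
  then show ?thesis using A sub unfolding good_family_def by (meson subsetD)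
qed

end

section \<open>Walks along the sets \<open>C a\<close>\<close>

locale ordinal_walk = successor_cardinal r l for r :: "'a rel" and l :: 'a +
  fixes S :: "'a set" and C :: "'a \<Rightarrow> 'a set" and g :: "'a \<Rightarrow> 'a"
  assumes C_cofinal: "cofinal_in r (underS r a) (C a)"
    and C_avoids: "x \<in> S \<Longrightarrow> x \<prec> a \<Longrightarrow> \<not> limit_point r (C a) x"
    and g_less: "g x \<prec> l"
    and stat_g: "k \<prec> l \<Longrightarrow> stat {x \<in> S. k \<preceq> g x}"
begin

text \<open>The standard step of a walk on ordinals. Taking the least candidate makes the value
  depend only on which elements of \<open>C \<beta>\<close> lie at or above
  \<open>\<alpha>\<close>.\<close>

definition step :: "'a \<Rightarrow> 'a \<Rightarrow> 'a" where
  "step \<alpha> \<beta> = (SOME c. c \<in> C \<beta> \<and> \<alpha> \<preceq> c \<and> (\<forall>c'\<in>C \<beta>. \<alpha> \<preceq> c' \<longrightarrow> c \<preceq> c'))"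

lemma step_between:
  assumes "\<alpha> \<prec> \<beta>"
  shows "\<alpha> \<preceq> step \<alpha> \<beta>" and "step \<alpha> \<beta> \<prec> \<beta>"
proof -
  have "\<exists>c. c \<in> C \<beta> \<and> \<alpha> \<preceq> c"
    using C_cofinal[of \<beta>] assms by (auto simp: cofinal_in_def)
  then obtain c where "c \<in> C \<beta> \<and> \<alpha> \<preceq> c" "\<And>c'. c' \<prec> c \<Longrightarrow> \<not> (c' \<in> C \<beta> \<and> \<alpha> \<preceq> c')"
    using ord.exists_least_iff[of "\<lambda>c. c \<in> C \<beta> \<and> \<alpha> \<preceq> c"] by blast
  then have "c \<in> C \<beta> \<and> \<alpha> \<preceq> c \<and> (\<forall>c'\<in>C \<beta>. \<alpha> \<preceq> c' \<longrightarrow> c \<preceq> c')"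
    using ord.not_less by blast
  then have "step \<alpha> \<beta> \<in> C \<beta> \<and> \<alpha> \<preceq> step \<alpha> \<beta> \<and> (\<forall>c'\<in>C \<beta>. \<alpha> \<preceq> c' \<longrightarrow> step \<alpha> \<beta> \<preceq> c')"
    unfolding step_def by (rule someI)
  then show "\<alpha> \<preceq> step \<alpha> \<beta>" "step \<alpha> \<beta> \<prec> \<beta>"
    using C_cofinal[of \<beta>] by (auto simp: cofinal_in_def)
qed

text \<open>As \<open>x\<close> is not a limit point of \<open>C \<beta>\<close>, some interval from
  \<open>e\<close> to \<open>x\<close> contains no element of \<open>C \<beta>\<close>; for
  \<open>\<alpha>\<close> inside it the candidates are the same as for \<open>x\<close>.\<close>

lemma step_eq:
  assumes "x \<in> S" and "x \<prec> \<beta>" and "\<exists>v. v \<prec> x"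
  shows "\<exists>e. e \<prec> x \<and> (\<forall>\<alpha>. e \<prec> \<alpha> \<and> \<alpha> \<prec> x \<longrightarrow> step \<alpha> \<beta> = step x \<beta>)"
proof -
  have "\<not> limit_point r (C \<beta>) x" using C_avoids assms by blast
  moreover have "underS r x \<noteq> {}" using assms(3) mem_underS by blast
  ultimately obtain e where e: "e \<prec> x" "\<And>c. c \<in> C \<beta> \<Longrightarrow> \<not> (e \<prec> c \<and> c \<prec> x)"
    unfolding limit_point_def by (metis mem_underS)
  have "step \<alpha> \<beta> = step x \<beta>" if \<alpha>: "e \<prec> \<alpha>" "\<alpha> \<prec> x" for \<alpha>
  proof -
    have "\<alpha> \<preceq> c \<longleftrightarrow> x \<preceq> c" if "c \<in> C \<beta>" for c
    proof
      assume "\<alpha> \<preceq> c"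
      then have "e \<prec> c" using \<alpha> ord.less_le_trans by blast
      then show "x \<preceq> c" using e(2)[OF that] ord.not_less by blast
    next
      assume "x \<preceq> c"
      then show "\<alpha> \<preceq> c" using \<alpha>(2) ord.less_imp_le ord.order_trans by blast
    qed
    then show ?thesis unfolding step_def by (intro arg_cong[where f = Eps] ext) auto
  qed
  then show ?thesis using e(1) by blast
qed

text \<open>For \<open>\<alpha> \<preceq> \<beta>\<close>, the recursion ends in
  \<open>\<alpha>\<close> itself if no earlier point of the walk has height at least
  \<open>k\<close>.\<close>

function first :: "'a \<Rightarrow> 'a \<Rightarrow> 'a \<Rightarrow> 'a" where
  "first k \<alpha> \<beta> = (if \<alpha> \<prec> \<beta> \<and> g \<beta> \<prec> k then first k \<alpha> (step \<alpha> \<beta>) else \<beta>)"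
  by pat_completeness auto
termination
  by (relation "inv_image {(x, y). x \<prec> y} (\<lambda>(k, \<alpha>, \<beta>). \<beta>)")
    (use wf_lt step_between in auto)

declare first.simps [simp del]

text \<open>Induction along the walk from \<open>\<beta>\<close> to \<open>x\<close>: each step is
  unchanged on an interval below \<open>x\<close>, and only finitely many heights are passed, so
  some \<open>j\<close> bounds them all and the search does not stop before
  \<open>x\<close>.\<close>

lemma first_through:
  assumes x: "x \<in> S" "\<exists>v. v \<prec> x" and "x \<preceq> \<beta>"
  shows "\<exists>e j. e \<prec> x \<and> j \<prec> l \<and>
    (\<forall>k \<alpha>. j \<prec> k \<and> e \<prec> \<alpha> \<and> \<alpha> \<prec> x \<longrightarrow> first k \<alpha> \<beta> = first k \<alpha> x)"
  using assms(3)
proof (induction \<beta> rule: ord.less_induct)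
  case (less \<beta>)
  show ?case
  proof (cases "x = \<beta>")
    case True
    then show ?thesis using x(2) g_less by blast
  next
    case False
    then have lt: "x \<prec> \<beta>" using less.prems by (simp add: olt_def)
    obtain e j where ej: "e \<prec> x" "j \<prec> l" and
      ih: "\<And>k \<alpha>. j \<prec> k \<Longrightarrow> e \<prec> \<alpha> \<Longrightarrow> \<alpha> \<prec> x \<Longrightarrow> first k \<alpha> (step x \<beta>) = first k \<alpha> x"
      using less.IH[OF step_between(2)[OF lt] step_between(1)[OF lt]] by blast
    obtain e' where e': "e' \<prec> x"
      "\<And>\<alpha>. e' \<prec> \<alpha> \<Longrightarrow> \<alpha> \<prec> x \<Longrightarrow> step \<alpha> \<beta> = step x \<beta>"
      using step_eq[OF x(1) lt x(2)] by blast
    obtain e'' where e'': "e \<preceq> e''" "e' \<preceq> e''" "e'' \<prec> x"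
      using common_bound[OF ej(1) e'(1)] by blast
    obtain j' where j': "j \<preceq> j'" "g \<beta> \<preceq> j'" "j' \<prec> l"
      using common_bound[OF ej(2) g_less] by blast
    have "first k \<alpha> \<beta> = first k \<alpha> x" if k: "j' \<prec> k" "e'' \<prec> \<alpha>" "\<alpha> \<prec> x" for k \<alpha>
    proof -
      have "\<alpha> \<prec> \<beta>" using k(3) lt by (rule ord.less_trans)
      moreover have "g \<beta> \<prec> k" using j'(2) k(1) by (rule ord.le_less_trans)
      ultimately have "first k \<alpha> \<beta> = first k \<alpha> (step \<alpha> \<beta>)" using first.simps[of k \<alpha> \<beta>] by simp
      also have "step \<alpha> \<beta> = step x \<beta>"
        using e'(2) e''(2) k ord.le_less_trans by blast
      also have "first k \<alpha> \<dots> = first k \<alpha> x"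
        using ih j'(1) e''(1) k ord.le_less_trans by blast
      finally show ?thesis .
    qed
    then show ?thesis using e''(3) j'(3) by blast
  qed
qed

text \<open>The height of \<open>x\<close> stops the search at \<open>x\<close> at the latest, and
  up to there the walk does not depend on \<open>\<alpha>\<close>. The bound
  \<open>x \<preceq> w\<close> later puts an ordinal \<open>\<eta>\<close> below \<open>x\<close>
  inside \<open>w\<close>.\<close>

lemma first_stops:
  assumes x: "x \<in> S" "\<exists>v. v \<prec> x" "k \<preceq> g x" and "x \<preceq> \<delta>"
  shows "\<exists>e w. e \<prec> x \<and> x \<preceq> w \<and> (\<forall>\<alpha>. e \<prec> \<alpha> \<and> \<alpha> \<prec> x \<longrightarrow> first k \<alpha> \<delta> = w)"
  using assms(4)
proof (induction \<delta> rule: ord.less_induct)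
  case (less \<delta>)
  show ?case
  proof (cases "g \<delta> \<prec> k")
    case False
    then have "first k \<alpha> \<delta> = \<delta>" for \<alpha> using first.simps[of k \<alpha> \<delta>] by simp
    then show ?thesis using x(2) less.prems by blast
  next
    case True
    then have "x \<noteq> \<delta>" using x(3) ord.not_less by blast
    then have lt: "x \<prec> \<delta>" using less.prems by (simp add: olt_def)
    obtain e w where ew: "e \<prec> x" "x \<preceq> w" and
      ih: "\<And>\<alpha>. e \<prec> \<alpha> \<Longrightarrow> \<alpha> \<prec> x \<Longrightarrow> first k \<alpha> (step x \<delta>) = w"
      using less.IH[OF step_between(2)[OF lt] step_between(1)[OF lt]] by blast
    obtain e' where e': "e' \<prec> x"
      "\<And>\<alpha>. e' \<prec> \<alpha> \<Longrightarrow> \<alpha> \<prec> x \<Longrightarrow> step \<alpha> \<delta> = step x \<delta>"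
      using step_eq[OF x(1) lt x(2)] by blast
    obtain e'' where e'': "e \<preceq> e''" "e' \<preceq> e''" "e'' \<prec> x"
      using common_bound[OF ew(1) e'(1)] by blast
    have "first k \<alpha> \<delta> = w" if \<alpha>: "e'' \<prec> \<alpha>" "\<alpha> \<prec> x" for \<alpha>
    proof -
      have "\<alpha> \<prec> \<delta>" using \<alpha>(2) lt by (rule ord.less_trans)
      then have "first k \<alpha> \<delta> = first k \<alpha> (step \<alpha> \<delta>)" using True first.simps[of k \<alpha> \<delta>] by simp
      also have "step \<alpha> \<delta> = step x \<delta>"
        using e'(2) e''(2) \<alpha> ord.le_less_trans by blast
      also have "first k \<alpha> \<dots> = w"
        using ih e''(1) \<alpha> ord.le_less_trans by blast
      finally show ?thesis .
    qed
    then show ?thesis using ew(2) e''(3) by blast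
  qed
qed

text \<open>For one \<open>\<delta>\<close>, the bounds of \<open>first_through\<close> vary over a
  set of size below \<open>chi\<close>; the cofinalities of \<open>\<delta>\<close> and of
  \<open>l\<close> make them uniform. Fodor's lemma then makes them independent of
  \<open>\<delta>\<close>.\<close>

lemma uniform_first:
  assumes S_cf: "S \<subseteq> {a. cf_ge r a chi}" and l_cf: "cf_ge r l chi"
    and small: "\<forall>b\<in>B. |b| <o |underS r chi|"
    and above: "\<forall>x. \<exists>b\<in>B. \<forall>y\<in>b. x \<prec> y"
  shows "\<exists>T e k. k \<prec> l \<and> stat T \<and> (\<forall>\<delta>\<in>T. \<exists>b\<in>B. \<forall>\<beta>\<in>b. \<delta> \<prec> \<beta> \<and>
    (\<forall>\<alpha>. e \<prec> \<alpha> \<and> \<alpha> \<prec> \<delta> \<longrightarrow> first k \<alpha> \<beta> = first k \<alpha> \<delta>))"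
proof -
  obtain z where z: "z \<prec> l" using g_less by blast
  have "stat S" using stat_g[OF z] by (rule stat_mono) blast
  \<comment> \<open>Lying above \<open>z\<close> ensures that \<open>\<delta>\<close> is not the
    least element, as \<open>first_through\<close> requires.\<close>
  then have S': "stat {x \<in> S. z \<prec> x}" by (rule stat_above)
  define Q where "Q \<delta> e k \<longleftrightarrow> e \<prec> \<delta> \<and> k \<prec> l \<and> (\<exists>b\<in>B. \<forall>\<beta>\<in>b. \<delta> \<prec> \<beta> \<and>
    (\<forall>\<alpha>. e \<prec> \<alpha> \<and> \<alpha> \<prec> \<delta> \<longrightarrow> first k \<alpha> \<beta> = first k \<alpha> \<delta>))" for \<delta> e k
  have "\<exists>e k. Q \<delta> e k" if \<delta>: "\<delta> \<in> S" "z \<prec> \<delta>" for \<delta>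
  proof -
    obtain b where b: "b \<in> B" "\<And>\<beta>. \<beta> \<in> b \<Longrightarrow> \<delta> \<prec> \<beta>" using above by blast
    have "\<forall>\<beta>. \<exists>e j. \<beta> \<in> b \<longrightarrow> e \<prec> \<delta> \<and> j \<prec> l \<and>
        (\<forall>k \<alpha>. j \<prec> k \<and> e \<prec> \<alpha> \<and> \<alpha> \<prec> \<delta> \<longrightarrow> first k \<alpha> \<beta> = first k \<alpha> \<delta>)"
      using first_through[OF \<delta>(1)] \<delta>(2) b(2) ord.less_imp_le by meson
    then obtain e j where ej: "\<And>\<beta>. \<beta> \<in> b \<Longrightarrow> e \<beta> \<prec> \<delta>" "\<And>\<beta>. \<beta> \<in> b \<Longrightarrow> j \<beta> \<prec> l"
      "\<And>\<beta> k \<alpha>. \<beta> \<in> b \<Longrightarrow> j \<beta> \<prec> k \<Longrightarrow> e \<beta> \<prec> \<alpha> \<Longrightarrow> \<alpha> \<prec> \<delta> \<Longrightarrow> first k \<alpha> \<beta> = first k \<alpha> \<delta>"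
      by metis
    have "cf_ge r \<delta> chi" using S_cf \<delta>(1) by blast
    from cf_bound[of _ _ _ e, OF this bspec[OF small b(1)] ej(1)]
    obtain e' where e': "e' \<prec> \<delta>" "\<And>\<beta>. \<beta> \<in> b \<Longrightarrow> e \<beta> \<prec> e'" by blast
    from cf_bound[of _ _ _ j, OF l_cf bspec[OF small b(1)] ej(2)]
    obtain k where k: "k \<prec> l" "\<And>\<beta>. \<beta> \<in> b \<Longrightarrow> j \<beta> \<prec> k" by blast
    have "first k \<alpha> \<beta> = first k \<alpha> \<delta>" if "\<beta> \<in> b" "e' \<prec> \<alpha>" "\<alpha> \<prec> \<delta>" for \<alpha> \<beta>
      using ej(3)[OF that(1) k(2)[OF that(1)] _ that(3)] ord.less_trans[OF e'(2) that(2)] that(1)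
      by blast
    then have "Q \<delta> e' k" unfolding Q_def using e'(1) k(1) b by blast
    then show ?thesis by blast
  qed
  then obtain e k where Q: "\<And>\<delta>. \<delta> \<in> S \<Longrightarrow> z \<prec> \<delta> \<Longrightarrow> Q \<delta> (e \<delta>) (k \<delta>)"
    by metis
  have "\<exists>e' k'. stat {\<delta> \<in> {x \<in> S. z \<prec> x}. e \<delta> = e' \<and> k \<delta> = k'}"
    by (rule fodor_l[OF S']) (use Q in \<open>auto simp: Q_def\<close>)
  then obtain e' k' where T: "stat {\<delta> \<in> {x \<in> S. z \<prec> x}. e \<delta> = e' \<and> k \<delta> = k'}" (is "stat ?T")
    by blast
  have QT: "Q \<delta> e' k'" if "\<delta> \<in> ?T" for \<delta>
    using Q[of \<delta>] that by simp
  obtain \<delta> where "\<delta> \<in> ?T" using stat_unbounded[OF T] by blast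
  then have "k' \<prec> l" using QT[of \<delta>] by (simp only: Q_def)
  show ?thesis
  proof (intro exI conjI ballI)
    show "k' \<prec> l" "stat ?T" by fact+
    fix \<delta> assume "\<delta> \<in> ?T"
    then show "\<exists>b\<in>B. \<forall>\<beta>\<in>b. \<delta> \<prec> \<beta> \<and>
      (\<forall>\<alpha>. e' \<prec> \<alpha> \<and> \<alpha> \<prec> \<delta> \<longrightarrow> first k' \<alpha> \<beta> = first k' \<alpha> \<delta>)"
      using QT[of \<delta>] by (simp only: Q_def)
  qed
qed

end

section \<open>The new coloring and the translation of colors\<close>

locale stretched_coloring = ordinal_walk r l S C g
  for r :: "'a rel" and l :: 'a and S C g +
  fixes idx :: "'a \<Rightarrow> 'a \<Rightarrow> 'a" and enc :: "'a \<times> 'a \<times> 'a \<Rightarrow> 'a" and c :: "'a \<Rightarrow> 'a \<Rightarrow> 'a"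
  assumes idx_inj: "inj_on (idx w) (underS r w)"
    and idx_less: "v \<prec> w \<Longrightarrow> idx w v \<prec> l"
    and enc_inj: "inj_on enc (underS r l \<times> underS r l \<times> underS r l)"
    and enc_less: "k \<prec> l \<Longrightarrow> i \<prec> l \<Longrightarrow> m \<prec> l \<Longrightarrow> enc (k, i, m) \<prec> l"
begin

definition elt :: "'a \<Rightarrow> 'a \<Rightarrow> 'a" where
  "elt w = inv_into (underS r w) (idx w)"

lemma elt_idx: "v \<prec> w \<Longrightarrow> elt w (idx w v) = v"
  unfolding elt_def by (rule inv_into_f_f[OF idx_inj]) simp

definition cplus :: "'a \<Rightarrow> 'a \<Rightarrow> 'a" where
  "cplus \<alpha> \<beta> = (case inv_into (underS r l \<times> underS r l \<times> underS r l) enc (c \<alpha> \<beta>) of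
     (k, i, m) \<Rightarrow> elt (elt (first k \<alpha> \<beta>) i) m)"

lemma cplus_eq:
  assumes "c \<alpha> \<beta> = enc (k, i, m)" and "k \<prec> l" "i \<prec> l" "m \<prec> l"
  shows "cplus \<alpha> \<beta> = elt (elt (first k \<alpha> \<beta>) i) m"
  unfolding cplus_def assms(1) using assms(2-4) by (subst inv_into_f_f[OF enc_inj]) auto

text \<open>\<open>e\<close> and \<open>\<tau>'\<close> do not depend on \<open>x\<close>, so the
  relation for \<open>c\<close> can be applied to the sets \<open>b x\<close> together, while each
  \<open>x\<close> certifies the colors of the pairs that straddle it.\<close>

lemma transfer_colors:
  assumes S_cf: "S \<subseteq> {a. cf_ge r a chi}" and l_cf: "cf_ge r l chi"
    and small: "\<forall>b\<in>B. |b| <o |underS r chi|"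
    and above: "\<forall>x. \<exists>b\<in>B. \<forall>y\<in>b. x \<prec> y"
    and mu: "mu \<preceq> l"
  shows "\<exists>R b e \<tau>'. stat R \<and> (\<forall>m. m \<prec> mu \<longrightarrow> \<tau>' m \<prec> l) \<and>
    (\<forall>x\<in>R. e \<prec> x \<and> b x \<in> B \<and> (\<forall>\<beta>\<in>b x. x \<prec> \<beta> \<and> (\<forall>\<alpha> m. e \<prec> \<alpha> \<and> \<alpha> \<prec> x \<and> m \<prec> mu \<and>
      c \<alpha> \<beta> = \<tau>' m \<longrightarrow> cplus \<alpha> \<beta> = \<tau> m)))"
proof -
  obtain T e k where k: "k \<prec> l" and T: "stat T" and
    through: "\<And>\<delta>. \<delta> \<in> T \<Longrightarrow> \<exists>b\<in>B. \<forall>\<beta>\<in>b. \<delta> \<prec> \<beta> \<and>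
      (\<forall>\<alpha>. e \<prec> \<alpha> \<and> \<alpha> \<prec> \<delta> \<longrightarrow> first k \<alpha> \<beta> = first k \<alpha> \<delta>)"
    using uniform_first[OF S_cf l_cf small above] by metis
  have "underS r mu \<subseteq> underS r l" using mu ord.less_le_trans by auto
  then have "|\<tau> ` underS r mu| \<le>o |underS r l|"
    using card_of_image card_of_mono1 ordLeq_transitive by blast
  then obtain \<eta> where \<eta>: "\<And>m. m \<prec> mu \<Longrightarrow> \<tau> m \<prec> \<eta>"
    using bounded by (meson imageI mem_underS)
  have S': "stat {x \<in> {x \<in> S. k \<preceq> g x}. \<eta> \<prec> x}"
    by (intro stat_above[OF stat_g] k)
  define P where "P x e' i b \<longleftrightarrow> e' \<prec> x \<and> i \<prec> l \<and> b \<in> B \<and> (\<forall>\<beta>\<in>b. x \<prec> \<beta> \<and>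
    (\<forall>\<alpha>. e \<prec> \<alpha> \<and> e' \<prec> \<alpha> \<and> \<alpha> \<prec> x \<longrightarrow> elt (first k \<alpha> \<beta>) i = \<eta>))" for x e' i b
  have "\<exists>e' i b. P x e' i b" if x: "x \<in> S" "k \<preceq> g x" "\<eta> \<prec> x" for x
  proof -
    \<comment> \<open>Below \<open>\<delta>\<close> the searches from all
      \<open>\<beta> \<in> b\<close> agree with the search from \<open>\<delta>\<close>, so applying
      \<open>first_stops\<close> to that single walk yields one \<open>w\<close> for the whole of
      \<open>b\<close>.\<close>
    obtain \<delta> where \<delta>: "\<delta> \<in> T" "x \<prec> \<delta>" using stat_unbounded[OF T] by blast
    obtain b where b: "b \<in> B" "\<And>\<beta>. \<beta> \<in> b \<Longrightarrow> \<delta> \<prec> \<beta>"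
      "\<And>\<beta> \<alpha>. \<beta> \<in> b \<Longrightarrow> e \<prec> \<alpha> \<Longrightarrow> \<alpha> \<prec> \<delta> \<Longrightarrow> first k \<alpha> \<beta> = first k \<alpha> \<delta>"
      using through[OF \<delta>(1)] by blast
    obtain e' w where w: "e' \<prec> x" "x \<preceq> w"
      "\<And>\<alpha>. e' \<prec> \<alpha> \<Longrightarrow> \<alpha> \<prec> x \<Longrightarrow> first k \<alpha> \<delta> = w"
      using first_stops[OF x(1) _ x(2) ord.less_imp_le[OF \<delta>(2)]] x(3) by blast
    have \<eta>w: "\<eta> \<prec> w" using x(3) w(2) by (rule ord.less_le_trans)
    have "x \<prec> \<beta> \<and> (\<forall>\<alpha>. e \<prec> \<alpha> \<and> e' \<prec> \<alpha> \<and> \<alpha> \<prec> x \<longrightarrow> elt (first k \<alpha> \<beta>) (idx w \<eta>) = \<eta>)"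
      if "\<beta> \<in> b" for \<beta>
    proof (intro conjI allI impI)
      show "x \<prec> \<beta>" using \<delta>(2) b(2)[OF that] by (rule ord.less_trans)
      fix \<alpha> assume \<alpha>: "e \<prec> \<alpha> \<and> e' \<prec> \<alpha> \<and> \<alpha> \<prec> x"
      then have "first k \<alpha> \<beta> = w"
        using b(3)[OF that, of \<alpha>] w(3)[of \<alpha>] \<delta>(2) ord.less_trans by metis
      then show "elt (first k \<alpha> \<beta>) (idx w \<eta>) = \<eta>" using elt_idx[OF \<eta>w] by simp
    qed
    then have "P x e' (idx w \<eta>) b" unfolding P_def using w(1) b(1) idx_less[OF \<eta>w] by blast
    then show ?thesis by blast
  qed
  then obtain E I b where P: "\<And>x. x \<in> S \<Longrightarrow> k \<preceq> g x \<Longrightarrow> \<eta> \<prec> x \<Longrightarrow> P x (E x) (I x) (b x)"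
    by metis
  \<comment> \<open>The point \<open>w\<close> may vary with \<open>x\<close>, but the index of
    \<open>\<eta>\<close> in it lies below \<open>l\<close> and can be pressed down.\<close>
  have "\<exists>e' i. stat {x \<in> {x \<in> {x \<in> S. k \<preceq> g x}. \<eta> \<prec> x}. E x = e' \<and> I x = i}"
    by (rule fodor_l[OF S']) (use P in \<open>auto simp: P_def\<close>)
  then obtain e' i where "stat {x \<in> {x \<in> {x \<in> S. k \<preceq> g x}. \<eta> \<prec> x}. E x = e' \<and> I x = i}" (is "stat ?R")
    by blast
  moreover obtain e'' where e'': "e \<prec> e''" "e' \<prec> e''" using strict_bound2 by blast
  ultimately have R: "stat {x \<in> ?R. e'' \<prec> x}" (is "stat ?R'") by (intro stat_above)
  have PR: "P x e' i (b x)" if "x \<in> ?R'" for x using P that by blast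
  have i: "i \<prec> l" using stat_unbounded[OF R] PR unfolding P_def by blast
  \<comment> \<open>This color makes \<open>cplus\<close> find \<open>\<eta>\<close> through
    \<open>k\<close> and \<open>i\<close>, and then read off \<open>\<tau> m\<close> inside
    \<open>\<eta>\<close>.\<close>
  define \<tau>' where "\<tau>' m = enc (k, i, idx \<eta> (\<tau> m))" for m
  have "cplus \<alpha> \<beta> = \<tau> m"
    if x: "x \<in> ?R'" "\<beta> \<in> b x" "e'' \<prec> \<alpha>" "\<alpha> \<prec> x" and m: "m \<prec> mu" "c \<alpha> \<beta> = \<tau>' m" for x \<alpha> \<beta> m
  proof -
    have "e \<prec> \<alpha>" "e' \<prec> \<alpha>" using e'' x(3) ord.less_trans by blast+
    then have "elt (first k \<alpha> \<beta>) i = \<eta>" using PR[OF x(1)] x(2,4) unfolding P_def by blast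
    then show ?thesis
      using cplus_eq[OF m(2)[unfolded \<tau>'_def] k i] idx_less \<eta>[OF m(1)] elt_idx by simp
  qed
  moreover have "\<tau>' m \<prec> l" if "m \<prec> mu" for m
    using enc_less[OF k i] idx_less \<eta>[OF that] by (simp add: \<tau>'_def)
  moreover have "e'' \<prec> x \<and> b x \<in> B \<and> (\<forall>\<beta>\<in>b x. x \<prec> \<beta>)" if "x \<in> ?R'" for x
    using PR[OF that] that unfolding P_def by blast
  ultimately show ?thesis
    using R by (intro exI[of _ ?R'] exI[of _ b] exI[of _ e''] exI[of _ \<tau>']) blast
qed

text \<open>With \<open>pick\<close> the identity this serves \<^const>\<open>pr1\<close>; with \<open>pick b \<in> A\<close> lying above \<open>b\<close> it
serves \<^const>\<open>pr1_circ\<close>, where the subfamily \<open>A'\<close> can be \<open>A\<close> itself.\<close>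

lemma transfer_pairs:
  assumes S_cf: "S \<subseteq> {a. cf_ge r a chi}" and l_cf: "cf_ge r l chi"
    and chi: "is_cardinal r chi" and s: "s \<prec> chi" and mu: "mu \<preceq> l"
    and A: "good_family r s A" and B: "good_family r s B"
    and pick: "\<forall>b\<in>B. pick b \<in> A"
    and pick_above: "\<forall>b\<in>B. \<forall>x. (\<forall>y\<in>b. x \<prec> y) \<longrightarrow> (\<forall>y\<in>pick b. x \<prec> y)"
    and pick_not: "\<forall>b\<in>B. \<not> set_less r (pick b) b"
  shows "\<exists>\<tau>' B'. B' \<subseteq> B \<and> good_family r s B' \<and> good_family r s (pick ` B') \<and>
    (\<forall>m. m \<prec> mu \<longrightarrow> \<tau>' m \<prec> l) \<and> (\<forall>a\<in>pick ` B'. \<forall>b\<in>B'. set_less r a b \<longrightarrow>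
      (\<forall>\<alpha>\<in>a. \<forall>\<beta>\<in>b. \<forall>m. m \<prec> mu \<and> c \<alpha> \<beta> = \<tau>' m \<longrightarrow> cplus \<alpha> \<beta> = \<tau> m))"
proof -
  have small: "\<forall>b\<in>B. |b| <o |underS r chi|"
    using good_card[OF B] cardinal_underS[OF chi s] ordIso_ordLess_trans by blast
  obtain R b e \<tau>' where R: "stat R" and \<tau>': "\<And>m. m \<prec> mu \<Longrightarrow> \<tau>' m \<prec> l"
    and R1: "\<And>x. x \<in> R \<Longrightarrow> e \<prec> x" "\<And>x. x \<in> R \<Longrightarrow> b x \<in> B"
      "\<And>x. x \<in> R \<Longrightarrow> \<forall>y\<in>b x. x \<prec> y"
    and R2: "\<And>x \<alpha> \<beta> m. x \<in> R \<Longrightarrow> \<beta> \<in> b x \<Longrightarrow> e \<prec> \<alpha> \<Longrightarrow> \<alpha> \<prec> x \<Longrightarrow> m \<prec> mu \<Longrightarrow>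
      c \<alpha> \<beta> = \<tau>' m \<Longrightarrow> cplus \<alpha> \<beta> = \<tau> m"
    using transfer_colors[OF S_cf l_cf small allI[OF good_above[OF B]] mu, of \<tau>]
    by (elim exE conjE) (rule that, auto)
  have "\<exists>h. x \<in> R \<longrightarrow> (\<forall>y\<in>b x. y \<prec> h) \<and> (\<forall>y\<in>pick (b x). y \<prec> h)" for x
  proof (cases "x \<in> R")
    case True
    obtain u v where "\<forall>y\<in>b x. y \<prec> u" "\<forall>y\<in>pick (b x). y \<prec> v"
      using good_bounded[OF B] good_bounded[OF A] pick R1(2)[OF True] by metis
    moreover obtain h where "u \<prec> h" "v \<prec> h" using strict_bound2 by blast
    ultimately show ?thesis using ord.less_trans by metis
  qed simp
  then obtain h where h: "\<And>x y. x \<in> R \<Longrightarrow> y \<in> b x \<Longrightarrow> y \<prec> h x"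
    "\<And>x y. x \<in> R \<Longrightarrow> y \<in> pick (b x) \<Longrightarrow> y \<prec> h x" by metis
  \<comment> \<open>Closure under \<open>h\<close> separates members: for \<open>x \<prec> y\<close>
    in \<open>R'\<close>, both \<open>b x\<close> and \<open>pick (b x)\<close> lie below
    \<open>y\<close>.\<close>
  define R' where "R' = {x \<in> R. \<forall>v. v \<prec> x \<longrightarrow> h v \<prec> x}"
  have R': "stat R'" unfolding R'_def by (rule stat_closed[OF R])
  have unb: "\<exists>x\<in>R'. (\<forall>y\<in>b x. u \<prec> y) \<and> (\<forall>y\<in>pick (b x). u \<prec> y)" for u
  proof -
    obtain x where x: "x \<in> R'" "u \<prec> x" using stat_unbounded[OF R'] by blast
    then have xR: "x \<in> R" by (simp add: R'_def)
    have "\<forall>y\<in>b x. u \<prec> y" using R1(3)[OF xR] x(2) ord.less_trans by blast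
    moreover have "\<forall>y\<in>pick (b x). u \<prec> y"
      using bspec[OF pick_above R1(2)[OF xR]] calculation by (elim allE impE)
    ultimately show ?thesis using x(1) by (intro bexI[of _ x] conjI)
  qed
  have sub: "b ` R' \<subseteq> B" "pick ` b ` R' \<subseteq> A" using R1(2) pick by (auto simp: R'_def)
  have "cplus \<alpha> \<beta> = \<tau> m"
    if x: "x \<in> R'" "y \<in> R'" and less: "set_less r (pick (b y)) (b x)"
      and ab: "\<alpha> \<in> pick (b y)" "\<beta> \<in> b x" and m: "m \<prec> mu" "c \<alpha> \<beta> = \<tau>' m" for x y \<alpha> \<beta> m
  proof -
    have xR: "x \<in> R" "y \<in> R" using x by (auto simp: R'_def)
    \<comment> \<open>\<open>\<alpha>\<close> comes from \<open>y\<close> and \<open>\<beta>\<close>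
      from \<open>x\<close>. Equality contradicts \<open>pick_not\<close>, and
      \<open>x \<prec> y\<close> would put \<open>\<beta>\<close> below \<open>y\<close> but
      \<open>\<alpha>\<close> above it. So \<open>y \<prec> x\<close>, and \<open>\<alpha>\<close>
      lies between \<open>e\<close> and \<open>x\<close>.\<close>
    have "x \<noteq> y" using bspec[OF pick_not R1(2)[OF xR(1)]] less by blast
    moreover have "\<not> x \<prec> y"
    proof
      assume "x \<prec> y"
      then have "h x \<prec> y" using x(2) by (simp add: R'_def)
      then have "\<beta> \<prec> y" using h(1)[OF xR(1) ab(2)] ord.less_trans by blast
      moreover have "y \<prec> \<alpha>"
        using bspec[OF pick_above R1(2)[OF xR(2)]] R1(3)[OF xR(2)] ab(1) by blast
      moreover have "\<alpha> \<prec> \<beta>" using less ab by (simp add: set_less_def)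
      ultimately show False using ord.less_trans ord.less_irrefl by blast
    qed
    ultimately have "y \<prec> x" using ord.linorder_cases by blast
    then have "h y \<prec> x" using x(1) by (simp add: R'_def)
    then have "\<alpha> \<prec> x" using h(2)[OF xR(2) ab(1)] ord.less_trans by blast
    moreover have "y \<prec> \<alpha>"
      using bspec[OF pick_above R1(2)[OF xR(2)]] R1(3)[OF xR(2)] ab(1) by blast
    then have "e \<prec> \<alpha>" using R1(1)[OF xR(2)] ord.less_trans by blast
    ultimately show ?thesis using R2[OF xR(1) ab(2)] m by blast
  qed
  note conv = this
  have "good_family r s (b ` R')"
  proof (rule good_subfamily[OF B sub(1)])
    fix u
    obtain x where "x \<in> R'" "\<forall>y\<in>b x. u \<prec> y" using unb by meson
    then show "\<exists>d\<in>b ` R'. \<forall>y\<in>d. u \<prec> y" by (intro bexI[of _ "b x"] imageI)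
  qed
  moreover have "good_family r s (pick ` b ` R')"
  proof (rule good_subfamily[OF A sub(2)])
    fix u
    obtain x where "x \<in> R'" "\<forall>y\<in>pick (b x). u \<prec> y" using unb by meson
    then show "\<exists>d\<in>pick ` b ` R'. \<forall>y\<in>d. u \<prec> y"
      by (intro bexI[of _ "pick (b x)"] imageI)
  qed
  ultimately show ?thesis
    using sub(1) \<tau>' conv by (intro exI[of _ \<tau>'] exI[of _ "b ` R'"]) auto
qed

section \<open>Transfer of the two partition relations\<close>

lemma pr1_cplus:
  assumes S_cf: "S \<subseteq> {a. cf_ge r a chi}" and l_cf: "cf_ge r l chi"
    and chi: "is_cardinal r chi" and mu: "mu \<preceq> l"
    and p: "\<And>x y. x \<prec> y \<Longrightarrow> p x y \<prec> mu"
    and pr1: "pr1 r (underS r l) mu p c chi"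
  shows "pr1 r UNIV mu p cplus chi"
  unfolding pr1_def
proof (intro ballI allI impI)
  fix s A and \<tau> :: "'a \<Rightarrow> 'a"
  assume "s \<in> underS r chi" and A: "good_family r s A"
  then have s: "s \<prec> chi" by simp
  have not_less: "\<forall>a\<in>A. \<not> set_less r a a"
    using good_nonempty[OF A] by (force simp: set_less_def)
  obtain \<tau>' A' where A': "A' \<subseteq> A" "good_family r s A'" "\<And>m. m \<prec> mu \<Longrightarrow> \<tau>' m \<prec> l"
    and conv: "\<And>a b \<alpha> \<beta> m. a \<in> A' \<Longrightarrow> b \<in> A' \<Longrightarrow> set_less r a b \<Longrightarrow> \<alpha> \<in> a \<Longrightarrow> \<beta> \<in> b \<Longrightarrow>
      m \<prec> mu \<Longrightarrow> c \<alpha> \<beta> = \<tau>' m \<Longrightarrow> cplus \<alpha> \<beta> = \<tau> m"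
    using transfer_pairs[OF S_cf l_cf chi s mu A A ballI _ not_less, of \<tau>]
    by (simp add: image_ident) (elim exE conjE, rule that, auto)
  obtain a b where ab: "a \<in> A'" "b \<in> A'" "set_less r a b"
    "\<And>x y. x \<in> a \<Longrightarrow> y \<in> b \<Longrightarrow> c x y = \<tau>' (p x y)"
    using pr1 s A'(2,3) unfolding pr1_def by (metis mem_underS)
  have "cplus x y = \<tau> (p x y)" if "x \<in> a" "y \<in> b" for x y
    using conv[OF ab(1-3) that p ab(4)[OF that]] ab(3) that by (auto simp: set_less_def)
  then show "\<exists>a\<in>A. \<exists>b\<in>A. set_less r a b \<and> (\<forall>x\<in>a. \<forall>y\<in>b. cplus x y = \<tau> (p x y))"
    using ab A'(1) by blast
qed

text \<open>The subfamily must be chosen before \<open>\<tau>\<close>, while \<open>B'\<close>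
  depends on \<open>\<tau>\<close>. So \<open>A\<close> itself is offered, and for each
  \<open>\<tau>\<close> the relation for \<open>c\<close> is applied to the image of
  \<open>B'\<close> under \<open>pick\<close> and to \<open>B'\<close>.\<close>

lemma pr1_circ_cplus:
  assumes S_cf: "S \<subseteq> {a. cf_ge r a chi}" and l_cf: "cf_ge r l chi"
    and chi: "is_cardinal r chi" and mu: "mu \<preceq> l"
    and p: "\<And>x y. x \<prec> y \<Longrightarrow> p x y \<prec> mu"
    and pr1: "pr1_circ r (underS r l) mu p c chi"
  shows "pr1_circ r UNIV mu p cplus chi"
  unfolding pr1_circ_def
proof (intro ballI allI impI exI[of _ A for A] conjI)
  fix s A B
  assume "s \<in> underS r chi" and "good_family r s A \<and> good_family r s B"
  then have s: "s \<prec> chi" and A: "good_family r s A" and B: "good_family r s B" by auto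
  show "A \<subseteq> A" "|A| =o |UNIV :: 'a set|" using A by (auto simp: good_family_def)
  fix \<tau> :: "'a \<Rightarrow> 'a"
  \<comment> \<open>A set above \<open>b\<close> inherits the lower bounds of \<open>b\<close> and
    cannot lie below \<open>b\<close>; these are the two conditions on \<open>pick\<close>.\<close>
  have "\<exists>a. b \<in> B \<longrightarrow> a \<in> A \<and> (\<forall>x\<in>a. \<forall>y\<in>b. y \<prec> x)" for b
    using good_bounded[OF B, of b] good_above[OF A] ord.less_trans by meson
  then obtain pick where pick: "\<forall>b\<in>B. pick b \<in> A"
    and over: "\<And>b x y. b \<in> B \<Longrightarrow> x \<in> pick b \<Longrightarrow> y \<in> b \<Longrightarrow> y \<prec> x" by metis
  have above: "\<forall>b\<in>B. \<forall>x. (\<forall>y\<in>b. x \<prec> y) \<longrightarrow> (\<forall>y\<in>pick b. x \<prec> y)"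
  proof (intro ballI allI impI)
    fix b x y assume b: "b \<in> B" "\<forall>y\<in>b. x \<prec> y" "y \<in> pick b"
    obtain z where "z \<in> b" using good_nonempty[OF B b(1)] by blast
    then show "x \<prec> y" using b(2) over[OF b(1,3)] ord.less_trans by blast
  qed
  have not_less: "\<forall>b\<in>B. \<not> set_less r (pick b) b"
  proof
    fix b assume b: "b \<in> B"
    obtain x where x: "x \<in> pick b" using good_nonempty[OF A bspec[OF pick b]] by blast
    obtain y where y: "y \<in> b" using good_nonempty[OF B b] by blast
    have "\<not> x \<prec> y" using over[OF b x y] ord.less_asym by blast
    then show "\<not> set_less r (pick b) b" using x y by (auto simp: set_less_def)
  qed
  obtain \<tau>' B' where B': "B' \<subseteq> B" "good_family r s B'" "good_family r s (pick ` B')"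
      "\<And>m. m \<prec> mu \<Longrightarrow> \<tau>' m \<prec> l"
    and conv: "\<And>a b \<alpha> \<beta> m. a \<in> pick ` B' \<Longrightarrow> b \<in> B' \<Longrightarrow> set_less r a b \<Longrightarrow> \<alpha> \<in> a \<Longrightarrow>
      \<beta> \<in> b \<Longrightarrow> m \<prec> mu \<Longrightarrow> c \<alpha> \<beta> = \<tau>' m \<Longrightarrow> cplus \<alpha> \<beta> = \<tau> m"
    using transfer_pairs[OF S_cf l_cf chi s mu A B pick above not_less, of \<tau>]
    by (elim exE conjE) (rule that, auto)
  have "s \<in> underS r chi" using s by simp
  from pr1[unfolded pr1_circ_def, THEN bspec, OF this, THEN spec, THEN spec, THEN mp,
      OF conjI, OF B'(3,2)]
  obtain A' where sub: "A' \<subseteq> pick ` B'" and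
    A': "\<forall>\<tau>. (\<forall>i\<in>underS r mu. \<tau> i \<in> underS r l) \<longrightarrow>
      (\<exists>a\<in>A'. \<exists>b\<in>B'. set_less r a b \<and> (\<forall>x\<in>a. \<forall>y\<in>b. c x y = \<tau> (p x y)))"
    by (elim exE conjE) (rule that)
  have "\<exists>a\<in>A'. \<exists>b\<in>B'. set_less r a b \<and> (\<forall>x\<in>a. \<forall>y\<in>b. c x y = \<tau>' (p x y))"
    by (rule A'[rule_format]) (use B'(4) in simp)
  then obtain a b where a: "a \<in> A'" and b: "b \<in> B'" and less: "set_less r a b"
    and eq: "\<And>x y. x \<in> a \<Longrightarrow> y \<in> b \<Longrightarrow> c x y = \<tau>' (p x y)"
    by blast
  have ab: "a \<in> pick ` B'" by (rule subsetD[OF sub a])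
  have "cplus x y = \<tau> (p x y)" if "x \<in> a" "y \<in> b" for x y
    using conv[OF ab b less that p eq[OF that]] less that by (auto simp: set_less_def)
  then show "\<exists>a\<in>A. \<exists>b\<in>B. set_less r a b \<and> (\<forall>x\<in>a. \<forall>y\<in>b. cplus x y = \<tau> (p x y))"
  proof (intro bexI conjI ballI)
    show "a \<in> A" "b \<in> B" using ab b B'(1) pick by auto
  qed (use less in auto)
qed

end

text \<open>The locale data are fixed before \<open>mu\<close> and \<open>p\<close>, and
  \<open>cplus\<close> is built from them and \<open>c\<close> alone; so one coloring serves all
  partitions.\<close>

theorem theorem3p5:
  fixes r :: "'a rel" and l chi :: 'a and S :: "'a set"
  assumes succ: "is_succ_of r l"
    and inf: "infinite (underS r l)"
    and chi_card: "is_cardinal r chi"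
    and chi_le: "cf_ge r l chi"
    and S_sub: "S \<subseteq> {a. cf_ge r a chi}"
    and S_nr: "nonreflecting_stationary r S"
  shows "\<forall>c :: 'a \<Rightarrow> 'a \<Rightarrow> 'a. (\<forall>x y. olt r x y \<longrightarrow> c x y \<in> underS r l) \<longrightarrow>
    (\<exists>cplus :: 'a \<Rightarrow> 'a \<Rightarrow> 'a. \<forall>mu (p :: 'a \<Rightarrow> 'a \<Rightarrow> 'a).
       is_cardinal r mu \<and> (mu, l) \<in> r \<and> (\<forall>x y. olt r x y \<longrightarrow> p x y \<in> underS r mu) \<longrightarrow>
       (pr1 r (underS r l) mu p c chi \<longrightarrow> pr1 r UNIV mu p cplus chi) \<and>
       (pr1_circ r (underS r l) mu p c chi \<longrightarrow> pr1_circ r UNIV mu p cplus chi))"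
proof (intro allI impI)
  fix c :: "'a \<Rightarrow> 'a \<Rightarrow> 'a"
  interpret successor_cardinal r l by standard (fact succ inf)+
  have "\<forall>a. \<exists>C. cofinal_in r (underS r a) C \<and> (\<forall>x\<in>S. olt r x a \<longrightarrow> \<not> limit_point r C x)"
    using S_nr by (intro allI ex_cofinal_avoiding) (auto simp: nonreflecting_stationary_def)
  then obtain C where C: "\<And>a. cofinal_in r (underS r a) (C a)"
    "\<And>x a. x \<in> S \<Longrightarrow> olt r x a \<Longrightarrow> \<not> limit_point r (C a) x" by metis
  have "stat S" using S_nr stationary_imp_stat by (simp add: nonreflecting_stationary_def)
  then obtain g where g: "\<And>x. olt r (g x) l"
    "\<And>k. olt r k l \<Longrightarrow> stat {x \<in> S. (k, g x) \<in> r}" using ex_height by metis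
  obtain idx where idx: "\<And>w. inj_on (idx w) (underS r w)"
    "\<And>w v. olt r v w \<Longrightarrow> olt r (idx w v) l" using ex_enumeration by metis
  let ?L = "underS r l"
  \<comment> \<open>Since \<open>l\<close> is infinite, triples of elements below \<open>l\<close>
    can be coded by single elements below \<open>l\<close>.\<close>
  have "|?L \<times> ?L \<times> ?L| \<le>o |?L|"
    by (intro card_of_Sigma_ordLeq_infinite[OF inf] ballI card_underS_le)
  then obtain enc where enc: "inj_on enc (?L \<times> ?L \<times> ?L)" "enc ` (?L \<times> ?L \<times> ?L) \<subseteq> ?L"
    unfolding card_of_ordLeq[symmetric] by blast
  interpret stretched_coloring r l S C g idx enc c
    by standard (use C g idx enc in \<open>auto simp: image_subset_iff\<close>)
  show "\<exists>cplus :: 'a \<Rightarrow> 'a \<Rightarrow> 'a. \<forall>mu (p :: 'a \<Rightarrow> 'a \<Rightarrow> 'a).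
       is_cardinal r mu \<and> (mu, l) \<in> r \<and> (\<forall>x y. olt r x y \<longrightarrow> p x y \<in> underS r mu) \<longrightarrow>
       (pr1 r (underS r l) mu p c chi \<longrightarrow> pr1 r UNIV mu p cplus chi) \<and>
       (pr1_circ r (underS r l) mu p c chi \<longrightarrow> pr1_circ r UNIV mu p cplus chi)"
    using pr1_cplus[OF S_sub chi_le chi_card] pr1_circ_cplus[OF S_sub chi_le chi_card]
    by (intro exI[of _ cplus]) simp
qed

end
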